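(* Given the dynamical system associated with the gradient flow for the objective function $$\bar E(A,B)=\mathbb{E}_{x,y}\Big[\tfrac12\|BAx-Ay\|^2\Big]+\tfrac{\lambda}{2}\big(\|A\|_F^2+\|B\|_F^2\big),$$ that is, $$\dot A=-\frac{\partial\bar E}{\partial A}(A,B),\qquad \dot B=-\frac{\partial\bar E}{\partial B}(A,B),$$ the matrix $A$ always converges to zero.
   Context: Here $A\in\mathbb{R}^{n\times m}$ (linear encoder $x\mapsto Ax$) and $B\in\mathbb{R}^{n\times n}$ (linear predictor $z\mapsto Bz$), with $n>m$; $(x,y)$ is a random pair in $\mathbb{R}^m\times\mathbb{R}^m$ (two views of a data point); $\|\cdot\|_F$ denotes the Frobenius norm; and $\lambda$ is the coefficient of the nonnegative regularizer $\frac{\lambda}{2}(\|A\|_F^2+\|B\|_F^2)$. The gradient with respect to $A$ is the full gradient, taking into account both occurrences of $A$ in $BAx-Ay$ (no stop gradient or exponential moving average is used).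
   Formalization: The regularization coefficient λ is taken strictly positive (for λ = 0 the claim fails: with x = y and B = I every A is stationary), and x, y are assumed to have finite second moments so that the objective is finite. *)

theory Defs
  imports "HOL-Probability.Probability"
begin

text \<open>
  Matrices with n rows and m columns have type \<open>real^'m^'n\<close>. The library's \<open>norm\<close> and \<open>inner\<close> on
  this type are the Frobenius norm and the Frobenius inner product, and gradients are taken
  with respect to the latter.
\<close>

definition Ebar ::
  "'a measure \<Rightarrow> ('a \<Rightarrow> real^'m) \<Rightarrow> ('a \<Rightarrow> real^'m) \<Rightarrow> real \<Rightarrow> real^'m^'n \<Rightarrow> real^'n^'n \<Rightarrow> real"
  where
  "Ebar M x y lam A B =
     (\<integral>\<omega>. 1/2 * (norm (B *v (A *v x \<omega>) - A *v y \<omega>))\<^sup>2 \<partial>M)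
       + lam / 2 * ((norm A)\<^sup>2 + (norm B)\<^sup>2)"

text \<open>Meaningful only where \<open>f\<close> is differentiable; the gradient is then unique.\<close>

definition gradient :: "('b::real_inner \<Rightarrow> real) \<Rightarrow> 'b \<Rightarrow> 'b"
  where "gradient f a = (THE D. GDERIV f a :> D)"

text \<open>
  \<open>A\<close> and \<open>B\<close> form a forward trajectory, with time \<open>t \<ge> 0\<close> and one-sided derivative at \<open>0\<close>,
  of the gradient flow of \<open>E\<close>. The initial values \<open>A 0\<close> and \<open>B 0\<close> are unconstrained.
\<close>

definition gradient_flow ::
  "('b::real_inner \<Rightarrow> 'c::real_inner \<Rightarrow> real) \<Rightarrow> (real \<Rightarrow> 'b) \<Rightarrow> (real \<Rightarrow> 'c) \<Rightarrow> bool"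
  where
  "gradient_flow E A B \<longleftrightarrow>
     (\<forall>t\<ge>0.
        (A has_vector_derivative - gradient (\<lambda>X. E X (B t)) (A t)) (at t within {0..}) \<and>
        (B has_vector_derivative - gradient (\<lambda>Y. E (A t) Y) (B t)) (at t within {0..}))"

end

theory Submission imports Defs
begin

text \<open>
  For fixed \<open>B\<close>, the expectation term of the objective is a quadratic form \<open>q\<close> in \<open>A\<close>, so Euler's
  identity gives \<open>A \<bullet> (\<partial>E/\<partial>A) = 2 q(A) + \<lambda> \<parallel>A\<parallel>\<^sup>2 \<ge> \<lambda> \<parallel>A\<parallel>\<^sup>2\<close>. Along the flow
  \<open>\<parallel>A\<parallel>\<^sup>2\<close> therefore decays at rate at least \<open>2 \<lambda>\<close>, whatever \<open>B\<close> does.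
\<close>

text \<open>\<open>gradient\<close> is a definite description, so existence and uniqueness must both
  be settled. The Riesz representative of the derivative, built from its values on
  \<open>Basis\<close>, satisfies \<open>GDERIV\<close>, and uniqueness of derivatives excludes any
  other. Afterwards gradients are used only through inner products, so no matrix formula for them
  has to be computed.\<close>

lemma inner_gradient:
  fixes f :: "'b::euclidean_space \<Rightarrow> real"
  assumes "(f has_derivative f') (at a)"
  shows "h \<bullet> gradient f a = f' h"
proof -
  define D where "D = (\<Sum>b\<in>Basis. f' b *\<^sub>R b)"
  have "linear f'"
    using assms has_derivative_linear by blast
  have "f' h = h \<bullet> D" for h
  proof -
    have "f' h = f' (\<Sum>b\<in>Basis. (h \<bullet> b) *\<^sub>R b)"
      by (simp only: euclidean_representation)
    also have "\<dots> = (\<Sum>b\<in>Basis. (h \<bullet> b) * f' b)"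
      using \<open>linear f'\<close> by (simp only: linear_sum linear_cmul real_scaleR_def)
    also have "\<dots> = h \<bullet> D"
      by (simp only: D_def inner_sum_right inner_scaleR_right mult.commute)
    finally show ?thesis .
  qed
  then have f': "f' = (\<lambda>h. h \<bullet> D)"
    by blast
  have "gradient f a = D"
    unfolding gradient_def
  proof (rule the_equality)
    show "GDERIV f a :> D"
      using assms by (simp add: gderiv_def f')
    show "D' = D" if "GDERIV f a :> D'" for D'
    proof -
      have "(\<lambda>h. h \<bullet> D') = (\<lambda>h. h \<bullet> D)"
        using has_derivative_unique that assms unfolding gderiv_def f' by blast
      then have "\<forall>h. h \<bullet> D' = h \<bullet> D"
        by (rule fun_cong[THEN allI])
      then show ?thesis
        by (simp only: vector_eq_ldot)
    qed
  qed
  then have "h \<bullet> gradient f a = h \<bullet> D"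
    by (rule arg_cong)
  then show ?thesis
    unfolding f' .
qed

text \<open>By Cauchy-Schwarz and \<open>2 * (a * b) \<le> a^2 + b^2\<close>, the sum of the two
  squared norms is an integrable majorant.\<close>

lemma integrable_inner_of_square_integrable:
  fixes f g :: "'a \<Rightarrow> 'b::euclidean_space"
  assumes [measurable]: "f \<in> borel_measurable M" "g \<in> borel_measurable M"
    and "integrable M (\<lambda>\<omega>. (norm (f \<omega>))\<^sup>2)" "integrable M (\<lambda>\<omega>. (norm (g \<omega>))\<^sup>2)"
  shows "integrable M (\<lambda>\<omega>. f \<omega> \<bullet> g \<omega>)"
proof (rule Bochner_Integration.integrable_bound)
  show "integrable M (\<lambda>\<omega>. (norm (f \<omega>))\<^sup>2 + (norm (g \<omega>))\<^sup>2)"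
    using assms by simp
  have "\<bar>u \<bullet> v\<bar> \<le> (norm u)\<^sup>2 + (norm v)\<^sup>2" for u v :: 'b
  proof -
    have "2 * (norm u * norm v) \<le> (norm u)\<^sup>2 + (norm v)\<^sup>2"
      using sum_squares_bound[of "norm u" "norm v"] by simp
    moreover have "\<bar>u \<bullet> v\<bar> \<le> norm u * norm v"
      by (rule Cauchy_Schwarz_ineq2)
    moreover have "0 \<le> norm u * norm v"
      by simp
    ultimately show ?thesis
      by linarith
  qed
  then show "AE \<omega> in M. norm (f \<omega> \<bullet> g \<omega>) \<le> norm ((norm (f \<omega>))\<^sup>2 + (norm (g \<omega>))\<^sup>2)"
    by simp
qed simp

lemma square_integrable_bounded_linear:
  fixes f :: "'b::euclidean_space \<Rightarrow> 'c::euclidean_space"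
  assumes f: "bounded_linear f" and [measurable]: "u \<in> borel_measurable M"
    and u: "integrable M (\<lambda>\<omega>. (norm (u \<omega>))\<^sup>2)"
  shows "integrable M (\<lambda>\<omega>. (norm (f (u \<omega>)))\<^sup>2)"
proof -
  have [measurable]: "f \<in> borel_measurable borel"
    using f by (intro borel_measurable_continuous_onI linear_continuous_on)
  obtain K where K: "\<And>v. norm (f v) \<le> norm v * K"
    using bounded_linear.bounded[OF f] by blast
  show ?thesis
  proof (rule Bochner_Integration.integrable_bound)
    show "integrable M (\<lambda>\<omega>. (norm (u \<omega>))\<^sup>2 * K\<^sup>2)"
      using u by simp
    have "(norm (f v))\<^sup>2 \<le> (norm v)\<^sup>2 * K\<^sup>2" for v
      using power_mono[OF K, of v 2] by (simp add: power_mult_distrib)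
    then show "AE \<omega> in M. norm ((norm (f (u \<omega>)))\<^sup>2) \<le> norm ((norm (u \<omega>))\<^sup>2 * K\<^sup>2)"
      by simp
  qed simp
qed

text \<open>Euler's identity for degree two: differentiating \<open>Q X X\<close> at
  \<open>a\<close> in the direction \<open>a\<close> gives \<open>Q a a\<close> twice. The constant
  \<open>d\<close> stands for the part of the regularizer that does not depend on
  \<open>X\<close>.\<close>

lemma inner_gradient_quadratic_form:
  fixes Q :: "'b::euclidean_space \<Rightarrow> 'b \<Rightarrow> real"
  assumes "bilinear Q"
  shows "a \<bullet> gradient (\<lambda>X. Q X X + c / 2 * ((norm X)\<^sup>2 + d)) a = 2 * Q a a + c * (norm a)\<^sup>2"
proof -
  interpret bounded_bilinear Q
    using assms by (simp add: bilinear_conv_bounded_bilinear)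
  \<comment> \<open>The squared norm is written as \<open>X \<bullet> X\<close> because
    \<open>norm\<close> itself is not differentiable at 0, and \<open>a\<close> may be 0.\<close>
  have "((\<lambda>X. Q X X + c / 2 * (X \<bullet> X + d)) has_derivative
      (\<lambda>h. Q a h + Q h a + c / 2 * (a \<bullet> h + h \<bullet> a))) (at a)"
    by (auto intro!: derivative_eq_intros FDERIV)
  from inner_gradient[OF this, of a] show ?thesis
    by (simp add: power2_norm_eq_inner)
qed

lemma inner_gradient_Ebar_ge:
  fixes x y :: "'a \<Rightarrow> real^'m" and A :: "real^'m^'n" and B :: "real^'n^'n"
  assumes [measurable]: "x \<in> borel_measurable M" "y \<in> borel_measurable M"
    and "integrable M (\<lambda>\<omega>. (norm (x \<omega>))\<^sup>2)" "integrable M (\<lambda>\<omega>. (norm (y \<omega>))\<^sup>2)"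
  shows "lam * (norm A)\<^sup>2 \<le> A \<bullet> gradient (\<lambda>X. Ebar M x y lam X B) A"
proof -
  \<comment> \<open>The residual is linear in each argument: linearity in the data pair
    \<open>p\<close> yields measurability and square integrability, linearity in \<open>X\<close>
    yields bilinearity of \<open>Q\<close>.\<close>
  define L :: "real^'m^'n \<Rightarrow> (real^'m) \<times> (real^'m) \<Rightarrow> real^'n"
    where "L X p = B *v (X *v fst p) - X *v snd p" for X p
  define u where "u \<omega> = (x \<omega>, y \<omega>)" for \<omega>
  have u[measurable]: "u \<in> borel_measurable M"
    unfolding u_def by measurable
  have int_u: "integrable M (\<lambda>\<omega>. (norm (u \<omega>))\<^sup>2)"
    using assms by (simp add: u_def norm_Pair)
  have L: "bounded_linear (L X)" for X
    unfolding linear_conv_bounded_linear[symmetric] L_def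
    by (rule linearI) (simp_all add: matrix_vector_right_distrib matrix_vector_mult_scaleR
        scaleR_diff_right)
  have meas[measurable]: "(\<lambda>\<omega>. L X (u \<omega>)) \<in> borel_measurable M" for X
    using u by (rule measurable_compose)
      (intro borel_measurable_continuous_onI linear_continuous_on L)
  \<comment> \<open>Needed for additivity of \<open>Q\<close>: the integral of a sum splits only for
    integrable summands.\<close>
  have int[simp]: "integrable M (\<lambda>\<omega>. L X (u \<omega>) \<bullet> L Y (u \<omega>))" for X Y
    by (rule integrable_inner_of_square_integrable[OF meas meas
          square_integrable_bounded_linear[OF L u int_u] square_integrable_bounded_linear[OF L u int_u]])
  have L_add: "L (X + Y) p = L X p + L Y p" for X Y p
    by (simp add: L_def matrix_vector_mult_add_rdistrib matrix_vector_right_distrib)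
  have L_scale: "L (c *\<^sub>R X) p = c *\<^sub>R L X p" for c X p
    by (simp only: L_def scaleR_matrix_vector_assoc[symmetric] matrix_vector_mult_scaleR
        scaleR_diff_right)
  define Q where "Q X Y = (\<integral>\<omega>. L X (u \<omega>) \<bullet> L Y (u \<omega>) \<partial>M) / 2" for X Y
  have "bilinear Q"
    unfolding bilinear_def Q_def
    by (auto intro!: linearI simp: L_add L_scale inner_add_left inner_add_right add_divide_distrib)
  moreover have "(\<lambda>X. Ebar M x y lam X B) = (\<lambda>X. Q X X + lam / 2 * ((norm X)\<^sup>2 + (norm B)\<^sup>2))"
    by (simp add: Ebar_def Q_def L_def u_def power2_norm_eq_inner)
  ultimately have "A \<bullet> gradient (\<lambda>X. Ebar M x y lam X B) A = 2 * Q A A + lam * (norm A)\<^sup>2"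
    using inner_gradient_quadratic_form by simp
  moreover have "0 \<le> Q A A"
    by (simp add: Q_def)
  ultimately show ?thesis
    by simp
qed

text \<open>A Gronwall argument: the integrating factor \<open>exp (2 * c * s)\<close> makes the
  squared norm nonincreasing; taking square roots halves the rate to \<open>c\<close>.\<close>

lemma norm_exponential_decay:
  fixes A :: "real \<Rightarrow> 'b::real_inner"
  assumes deriv: "\<And>t. 0 \<le> t \<Longrightarrow> (A has_vector_derivative A' t) (at t within {0..})"
    and dissip: "\<And>t. 0 \<le> t \<Longrightarrow> A t \<bullet> A' t \<le> - c * (norm (A t))\<^sup>2"
    and "0 \<le> t"
  shows "norm (A t) \<le> exp (- c * t) * norm (A 0)"
proof -
  define G where "G s = exp (2 * c * s) * (A s \<bullet> A s)" for s
  have G: "(G has_field_derivative exp (2 * c * s) * 2 * (c * (norm (A s))\<^sup>2 + A s \<bullet> A' s))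
      (at s within {0..})" if "0 \<le> s" for s
    unfolding G_def has_field_derivative_def
    using deriv[OF that] unfolding has_vector_derivative_def
    by (auto intro!: derivative_eq_intros simp: power2_norm_eq_inner algebra_simps inner_commute)
  have "G t \<le> G 0"
  \<comment> \<open>The sign of the derivative is checked only at interior times, where the
    derivative within \<open>{0..}\<close> is two-sided. At 0 continuity suffices.\<close>
  proof (rule DERIV_nonpos_imp_decreasing_open[OF \<open>0 \<le> t\<close>])
    fix s :: real assume s: "0 < s" "s < t"
    then have "(G has_field_derivative exp (2 * c * s) * 2 * (c * (norm (A s))\<^sup>2 + A s \<bullet> A' s)) (at s)"
      using G[of s] at_within_interior[of s "{0..}"] by simp
    moreover have "exp (2 * c * s) * 2 * (c * (norm (A s))\<^sup>2 + A s \<bullet> A' s) \<le> 0"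
      using dissip[of s] s by (intro mult_nonneg_nonpos) auto
    ultimately show "\<exists>d. (G has_field_derivative d) (at s) \<and> d \<le> 0"
      by blast
  next
    have "continuous_on {0..} G"
      using G by (auto intro!: DERIV_continuous_on)
    then show "continuous_on {0..t} G"
      by (rule continuous_on_subset) auto
  qed
  then have "(exp (c * t) * norm (A t))\<^sup>2 \<le> (norm (A 0))\<^sup>2"
    by (simp add: G_def power_mult_distrib exp_double[symmetric] mult.assoc power2_norm_eq_inner)
  then have "exp (c * t) * norm (A t) \<le> norm (A 0)"
    by (rule power2_le_imp_le) simp
  then show ?thesis
    by (simp add: exp_minus field_simps)
qed

theorem lemma4p3:
  fixes M :: "'a measure"
    and x y :: "'a \<Rightarrow> real^'m"
    and lam :: real
    and A :: "real \<Rightarrow> real^'m^'n"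
    and B :: "real \<Rightarrow> real^'n^'n"
  assumes "CARD('m) < CARD('n)"
    and "prob_space M"
    and "x \<in> borel_measurable M" and "y \<in> borel_measurable M"
    and "integrable M (\<lambda>\<omega>. (norm (x \<omega>))\<^sup>2)" and "integrable M (\<lambda>\<omega>. (norm (y \<omega>))\<^sup>2)"
    and "lam > 0"
    and "gradient_flow (Ebar M x y lam) A B"
  shows "(A \<longlongrightarrow> 0) at_top"
proof -
  \<comment> \<open>At each time \<open>s\<close> the dissipation estimate is applied with the
    current value \<open>B s\<close>, so no control of \<open>B\<close> along the trajectory
    enters.\<close>
  have "norm (A t) \<le> exp (- lam * t) * norm (A 0)" if "0 \<le> t" for t
  proof (rule norm_exponential_decay[OF _ _ that])
    show "(A has_vector_derivative - gradient (\<lambda>X. Ebar M x y lam X (B s)) (A s)) (at s within {0..})"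
      if "0 \<le> s" for s
      using assms(8) that by (simp add: gradient_flow_def)
    show "A s \<bullet> - gradient (\<lambda>X. Ebar M x y lam X (B s)) (A s) \<le> - lam * (norm (A s))\<^sup>2" for s
      using inner_gradient_Ebar_ge[OF assms(3-6), of lam "A s" "B s"] by simp
  qed
  then have "\<forall>\<^sub>F t in at_top. norm (A t) \<le> exp (- lam * t) * norm (A 0)"
    using eventually_ge_at_top[of 0] by (rule eventually_mono[rotated])
  moreover have "((\<lambda>t. exp (- lam * t) * norm (A 0)) \<longlongrightarrow> 0) at_top"
  proof -
    \<comment> \<open>Positivity of \<open>lam\<close> turns the exponential bound into
      convergence.\<close>
    have "filterlim (\<lambda>t. - lam * t) at_bot at_top"
      using \<open>lam > 0\<close> filterlim_tendsto_neg_mult_at_bot[OF tendsto_const, of "- lam" "\<lambda>t. t" at_top]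
      by (simp add: filterlim_ident)
    then have "((\<lambda>t. exp (- lam * t)) \<longlongrightarrow> 0) at_top"
      by (rule filterlim_compose[OF exp_at_bot])
    then show ?thesis
      by (rule tendsto_mult_left_zero)
  qed
  ultimately show ?thesis
    by (rule Lim_null_comparison)
qed

end
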